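(* Let $U$ be a nonsingular real $n\times n$ matrix such that $U^{-1}=\mathbb{I}-P$, where $P\ge 0$ and $P\mathbf 1\le \mathbf 1$. Then for every real $\alpha\ge 1$ there is a matrix $Q(\alpha)$ with $Q(\alpha)\ge 0$ and $Q(\alpha)\mathbf 1\le\mathbf 1$ such that $U^{(\alpha)}$ is nonsingular and $(U^{(\alpha)})^{-1}=\mathbb{I}-Q(\alpha)$. Moreover, if $P'\mathbf 1\le\mathbf 1$, then $Q(\alpha)'\mathbf 1\le\mathbf 1$.
   Context: Inequalities are entrywise; $'$ denotes transpose; $\mathbb{I}$ is the identity matrix and $\mathbf 1$ the vector of ones. $U^{(\alpha)}$ denotes the entrywise power, $(U^{(\alpha)})_{ij}=(U_{ij})^\alpha$ (under the hypotheses $U$ is entrywise nonnegative). *)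

theory Defs
  imports "HOL-Analysis.Analysis"
begin

text \<open>
  On \<open>real ^ 'n ^ 'n\<close> the constant \<open>0\<close> and the order \<open>\<le>\<close> are entrywise; on \<open>real ^ 'n\<close> the
  constant \<open>1\<close> is the vector of ones, whereas the identity matrix is \<open>mat 1\<close>.
\<close>

text \<open>
  Since \<open>0 powr \<alpha> = 0\<close> for every \<open>\<alpha>\<close>, the use of \<open>powr\<close> below is the usual power for
  nonnegative entries and \<open>\<alpha> > 0\<close>; on negative entries it carries no meaning.
\<close>

definition entrywise_powr :: "real ^ 'n ^ 'm \<Rightarrow> real \<Rightarrow> real ^ 'n ^ 'm" where
  "entrywise_powr U \<alpha> = (\<chi> i j. (U $ i $ j) powr \<alpha>)"

end

theory Submission
  imports Defs
begin

text \<open>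
  Induction over principal submatrices. Let \<open>A\<close> be a principal submatrix of \<open>U\<close>, and call \<open>b\<close> a
  potential if \<open>b = A \<xi>\<close> with \<open>\<xi> \<ge> 0\<close>. Write \<open>V\<close>, \<open>b\<^sup>p\<close>, \<open>c\<^sup>p\<close> for entrywise powers. The heart is an
  inequality of Jensen type: if \<open>c = \<mu> A\<close> with \<open>\<mu> \<ge> 0\<close>, and \<open>x \<ge> 0\<close> solves \<open>V x = b\<^sup>p\<close>, then
  \<open>c\<^sup>p x \<le> (\<mu> b)\<^sup>p\<close>. When a row \<open>i\<close> is added to \<open>A\<close>, this inequality for the column \<open>i\<close> makes the Schur
  complement in \<open>V\<close> positive, and for a general potential \<open>b\<close> it makes the coordinate \<open>i\<close> of the
  solution of \<open>V x = b\<^sup>p\<close> nonnegative; as \<open>i\<close> is arbitrary, the whole solution is nonnegative.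
  Nonnegative solutions for the columns of \<open>U\<close> give the signs off the diagonal of the inverse of
  \<open>U\<^sup>p\<close>, and those for the potential \<open>b = 1\<close> give its row sums (its column sums by transposition). The diagonal
  entries of the inverse are at most \<open>1\<close> because \<open>d\<^sup>p - s\<^sup>p \<ge> 1\<close> whenever \<open>d \<ge> s + 1\<close> and \<open>s \<ge> 0\<close>.
\<close>

section \<open>Jensen's inequality for weighted sums and for potentials\<close>

text \<open>Jensen for the convex function \<open>t powr p\<close>, with the weights normalised by
  their sum; clearing that denominator produces the factor with exponent
  \<open>p - 1\<close>.\<close>

lemma powr_sum_mult_le:
  fixes w t :: "'a \<Rightarrow> real"
  assumes "finite S" and p: "1 \<le> p"
    and w: "\<And>i. i \<in> S \<Longrightarrow> 0 \<le> w i" and t: "\<And>i. i \<in> S \<Longrightarrow> 0 \<le> t i"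
  shows "(\<Sum>i\<in>S. w i * t i) powr p \<le> (\<Sum>i\<in>S. w i) powr (p - 1) * (\<Sum>i\<in>S. w i * t i powr p)"
proof -
  \<comment> \<open>Convexity is used on the open half-line with weights of positive total, so
    indices where \<open>w\<close> or \<open>t\<close> vanishes are removed first; they add nothing
    to the sums that contain \<open>t\<close>.\<close>
  define R where "R = {i \<in> S. 0 < w i \<and> 0 < t i}"
  define W where "W = sum w R"
  have R: "finite R" "R \<subseteq> S" using assms(1) by (auto simp: R_def)
  have out: "w i = 0 \<or> t i = 0" if "i \<in> S - R" for i
    using that w[of i] t[of i] by (force simp: R_def)
  have eq1: "(\<Sum>i\<in>S. w i * t i) = (\<Sum>i\<in>R. w i * t i)"
    using out by (intro sum.mono_neutral_right assms(1) R) auto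
  have eq2: "(\<Sum>i\<in>S. w i * t i powr p) = (\<Sum>i\<in>R. w i * t i powr p)"
    using out by (intro sum.mono_neutral_right assms(1) R) auto
  show ?thesis
  proof (cases "R = {}")
    case True
    then show ?thesis unfolding eq1 eq2 by simp
  next
    case False
    then have W: "0 < W" unfolding W_def using R by (intro sum_pos) (auto simp: R_def)
    have "(\<Sum>i\<in>R. (w i / W) *\<^sub>R t i) powr p \<le> (\<Sum>i\<in>R. (w i / W) * t i powr p)"
      using W R False p
      by (intro convex_on_sum[where C="{0<..}" and f="\<lambda>x. x powr p"] powr_convex R)
         (auto simp: R_def W_def simp flip: sum_divide_distrib)
    then have "((\<Sum>i\<in>R. w i * t i) / W) powr p \<le> (\<Sum>i\<in>R. w i * t i powr p) / W"
      by (simp add: sum_divide_distrib)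
    then have "(\<Sum>i\<in>R. w i * t i) powr p \<le> (\<Sum>i\<in>R. w i * t i powr p) / W * W powr p"
      using W by (subst (asm) powr_divide) (auto simp: R_def field_simps intro!: sum_nonneg)
    also have "\<dots> = W powr (p - 1) * (\<Sum>i\<in>R. w i * t i powr p)"
      using W by (simp add: powr_diff)
    also have "\<dots> \<le> (\<Sum>i\<in>S. w i) powr (p - 1) * (\<Sum>i\<in>R. w i * t i powr p)"
    proof (intro mult_right_mono powr_mono2)
      show "W \<le> sum w S" unfolding W_def using assms(1) R w by (intro sum_mono2) auto
    qed (use p W R w in \<open>auto intro!: sum_nonneg\<close>)
    finally show ?thesis unfolding eq1 eq2 .
  qed
qed

text \<open>Weights \<open>\<mu> l * b l\<close> turn the combination of the \<open>A l k\<close>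
  into a weighted sum of the ratios \<open>A l k / b l\<close>. After Jensen and an exchange of
  sums, the equations \<open>Vx\<close> make each inner sum equal to \<open>b l powr p\<close>,
  which cancels the denominators and leaves \<open>s powr (p - 1) * s\<close>.\<close>

lemma powr_potential_le:
  fixes A :: "'a \<Rightarrow> 'a \<Rightarrow> real"
  assumes T: "finite T" and p: "1 \<le> p"
    and A: "\<And>i j. i \<in> T \<Longrightarrow> j \<in> T \<Longrightarrow> 0 \<le> A i j"
    and mu: "\<And>l. l \<in> T \<Longrightarrow> 0 \<le> \<mu> l"
    and b: "\<And>l. l \<in> T \<Longrightarrow> 0 \<le> b l"
    and x: "\<And>k. k \<in> T \<Longrightarrow> 0 \<le> x k"
    and Vx: "\<And>l. l \<in> T \<Longrightarrow> (\<Sum>k\<in>T. A l k powr p * x k) = b l powr p"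
  shows "(\<Sum>k\<in>T. (\<Sum>l\<in>T. \<mu> l * A l k) powr p * x k) \<le> (\<Sum>l\<in>T. \<mu> l * b l) powr p"
proof -
  define L where "L = {l \<in> T. 0 < b l}"
  define s where "s = (\<Sum>l\<in>L. \<mu> l * b l)"
  have L: "finite L" "L \<subseteq> T" using T by (auto simp: L_def)
  have s0: "0 \<le> s" unfolding s_def using L mu b by (intro sum_nonneg) auto
  have s: "(\<Sum>l\<in>T. \<mu> l * b l) = s"
    unfolding s_def by (intro sum.mono_neutral_right T L) (use b in \<open>force simp: L_def\<close>)
  \<comment> \<open>Rows where \<open>b\<close> vanishes contribute nothing, because \<open>x\<close> is nonnegative and solves \<open>V x = b\<^sup>p\<close>;
     on the others Jensen applies with weights \<open>\<mu> l * b l\<close>.\<close>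
  have col: "(\<Sum>l\<in>T. \<mu> l * A l k) powr p * x k
      \<le> s powr (p - 1) * (\<Sum>l\<in>L. \<mu> l * b l / b l powr p * (A l k powr p * x k))" if k: "k \<in> T" for k
  proof (cases "x k = 0")
    case False
    have "A l k = 0" if l: "l \<in> T - L" for l
    proof -
      have "b l = 0" using l b[of l] by (force simp: L_def)
      then have "(\<Sum>k\<in>T. A l k powr p * x k) = 0" using Vx[of l] l by simp
      then have "A l k powr p * x k = 0"
        using T x k by (subst (asm) sum_nonneg_eq_0_iff) auto
      then show ?thesis using False by simp
    qed
    then have "(\<Sum>l\<in>T. \<mu> l * A l k) = (\<Sum>l\<in>L. \<mu> l * A l k)"
      by (intro sum.mono_neutral_right T L) auto
    also have "\<dots> = (\<Sum>l\<in>L. (\<mu> l * b l) * (A l k / b l))"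
      by (intro sum.cong) (auto simp: L_def)
    also have "\<dots> powr p \<le> s powr (p - 1) * (\<Sum>l\<in>L. \<mu> l * b l * (A l k / b l) powr p)"
      unfolding s_def using L mu b A k p by (intro powr_sum_mult_le) auto
    also have "(\<Sum>l\<in>L. \<mu> l * b l * (A l k / b l) powr p) = (\<Sum>l\<in>L. \<mu> l * b l / b l powr p * A l k powr p)"
      using L A k b by (intro sum.cong) (auto simp: powr_divide subset_iff)
    finally have "(\<Sum>l\<in>T. \<mu> l * A l k) powr p * x k
        \<le> (s powr (p - 1) * (\<Sum>l\<in>L. \<mu> l * b l / b l powr p * A l k powr p)) * x k"
      using x[OF k] by (intro mult_right_mono) auto
    then show ?thesis by (simp add: sum_distrib_left sum_distrib_right mult_ac)
  qed simp
  have "(\<Sum>k\<in>T. (\<Sum>l\<in>T. \<mu> l * A l k) powr p * x k)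
      \<le> (\<Sum>k\<in>T. s powr (p - 1) * (\<Sum>l\<in>L. \<mu> l * b l / b l powr p * (A l k powr p * x k)))"
    by (intro sum_mono col)
  also have "\<dots> = s powr (p - 1) * (\<Sum>l\<in>L. \<mu> l * b l / b l powr p * (\<Sum>k\<in>T. A l k powr p * x k))"
    unfolding sum_distrib_left by (subst sum.swap) simp
  also have "\<dots> = s powr (p - 1) * s"
  proof -
    have "(\<Sum>l\<in>L. \<mu> l * b l / b l powr p * (\<Sum>k\<in>T. A l k powr p * x k)) = s"
      unfolding s_def using Vx by (intro sum.cong) (auto simp: L_def)
    then show ?thesis by simp
  qed
  also have "\<dots> = s powr p"
    using s0 by (cases "s = 0") (auto simp: powr_diff)
  finally show ?thesis unfolding s .
qed

section \<open>Inverse M-matrices and the deletion of one index\<close>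

text \<open>This says that \<open>M\<close> is a nonsingular M-matrix with inverse \<open>A\<close>.
  Entry functions on an index set, instead of matrices over a type, let a principal submatrix of
  \<open>A\<close> arise by shrinking \<open>S\<close> alone.\<close>

definition inverse_M_on :: "'a set \<Rightarrow> ('a \<Rightarrow> 'a \<Rightarrow> real) \<Rightarrow> ('a \<Rightarrow> 'a \<Rightarrow> real) \<Rightarrow> bool" where
  "inverse_M_on S A M \<longleftrightarrow>
    (\<forall>i\<in>S. \<forall>j\<in>S. 0 \<le> A i j) \<and> (\<forall>i\<in>S. \<forall>j\<in>S. i \<noteq> j \<longrightarrow> M i j \<le> 0) \<and>
    (\<forall>i\<in>S. \<forall>j\<in>S. (\<Sum>k\<in>S. A i k * M k j) = of_bool (i = j)) \<and>
    (\<forall>i\<in>S. \<forall>j\<in>S. (\<Sum>k\<in>S. M i k * A k j) = of_bool (i = j))"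

lemma inverse_M_on_transpose:
  assumes "inverse_M_on S A M"
  shows "inverse_M_on S (\<lambda>i j. A j i) (\<lambda>i j. M j i)"
proof -
  have "of_bool (i = j) = (of_bool (j = i) :: real)" for i j :: 'a by auto
  then show ?thesis using assms unfolding inverse_M_on_def by (simp add: mult.commute)
qed

text \<open>Otherwise every term of the diagonal entry of \<open>M\<close> times \<open>A\<close>
  would be nonpositive, while the entry is 1.\<close>

lemma inverse_M_on_diag_pos:
  assumes "finite S" "inverse_M_on S A M" "i \<in> S"
  shows "0 < M i i"
proof (rule ccontr)
  assume "\<not> 0 < M i i"
  then have "M i k * A k i \<le> 0" if "k \<in> S" for k
    using assms(2,3) that unfolding inverse_M_on_def
    by (cases "k = i") (auto intro!: mult_nonpos_nonneg)
  then have "(\<Sum>k\<in>S. M i k * A k i) \<le> 0" by (intro sum_nonpos)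
  then show False using assms(2,3) by (auto simp: inverse_M_on_def)
qed

context
  fixes S T :: "'a set" and A M :: "'a \<Rightarrow> 'a \<Rightarrow> real" and i :: 'a
  assumes fin: "finite T" and iT: "i \<notin> T" and S_def: "S = insert i T" and AM: "inverse_M_on S A M"
begin

lemma pivot_pos: "0 < M i i"
  using inverse_M_on_diag_pos[of S A M i] fin AM by (simp add: S_def)

lemma pivot_products:
  "j \<in> S \<Longrightarrow> l \<in> S \<Longrightarrow> (\<Sum>k\<in>T. A j k * M k l) = of_bool (j = l) - A j i * M i l"
  "j \<in> S \<Longrightarrow> l \<in> S \<Longrightarrow> (\<Sum>k\<in>T. M j k * A k l) = of_bool (j = l) - M j i * A i l"
proof -
  have split: "(\<Sum>k\<in>S. f k) = f i + (\<Sum>k\<in>T. f k)" for f :: "'a \<Rightarrow> real"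
    using fin iT by (simp add: S_def)
  show "j \<in> S \<Longrightarrow> l \<in> S \<Longrightarrow> (\<Sum>k\<in>T. A j k * M k l) = of_bool (j = l) - A j i * M i l"
    "j \<in> S \<Longrightarrow> l \<in> S \<Longrightarrow> (\<Sum>k\<in>T. M j k * A k l) = of_bool (j = l) - M j i * A i l"
    using AM by (simp_all add: inverse_M_on_def split eq_diff_eq add.commute)
qed

text \<open>The Schur complement of the pivot \<open>M i i\<close> in \<open>M\<close> inverts the
  submatrix of \<open>A\<close> on \<open>T\<close>. It keeps the sign pattern because the
  subtracted term is a product of two nonpositive entries over a positive pivot.\<close>

lemma inverse_M_on_delete:
  "inverse_M_on T A (\<lambda>k l. M k l - M k i * M i l / M i i)"
proof -
  have sgn: "M k l - M k i * M i l / M i i \<le> 0" if "k \<in> T" "l \<in> T" "k \<noteq> l" for k l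
  proof -
    have "M k l \<le> 0" "M k i \<le> 0" "M i l \<le> 0"
      using AM that iT by (auto simp: inverse_M_on_def S_def)
    moreover from this have "0 \<le> M k i * M i l / M i i"
      using pivot_pos by (intro divide_nonneg_pos mult_nonpos_nonpos)
    ultimately show ?thesis by linarith
  qed
  have right: "(\<Sum>k\<in>T. A j k * (M k l - M k i * M i l / M i i)) = of_bool (j = l)" if "j \<in> T" "l \<in> T" for j l
  proof -
    have "(\<Sum>k\<in>T. A j k * (M k l - M k i * M i l / M i i))
        = (\<Sum>k\<in>T. A j k * M k l) - (\<Sum>k\<in>T. A j k * M k i) * (M i l / M i i)"
      by (simp add: algebra_simps sum_subtractf sum_distrib_left)
    then show ?thesis
      using that iT pivot_pos by (auto simp: pivot_products S_def)
  qed
  have left: "(\<Sum>k\<in>T. (M j k - M j i * M i k / M i i) * A k l) = of_bool (j = l)" if "j \<in> T" "l \<in> T" for j l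
  proof -
    have "(\<Sum>k\<in>T. (M j k - M j i * M i k / M i i) * A k l)
        = (\<Sum>k\<in>T. M j k * A k l) - (M j i / M i i) * (\<Sum>k\<in>T. M i k * A k l)"
      by (simp add: algebra_simps sum_subtractf sum_distrib_left)
    then show ?thesis
      using that iT pivot_pos by (auto simp: pivot_products S_def)
  qed
  show ?thesis
    unfolding inverse_M_on_def using sgn left right AM by (auto simp: inverse_M_on_def S_def)
qed

text \<open>Entry \<open>(j, i)\<close> of the product of \<open>A\<close> and \<open>M\<close>,
  solved for \<open>A j i\<close>. Since \<open>pivot_weights\<close> makes the coefficients
  nonnegative, column \<open>i\<close> restricted to \<open>T\<close> is a potential of the
  submatrix.\<close>

lemma pivot_col:
  assumes "j \<in> T" shows "A j i = (\<Sum>k\<in>T. A j k * (- M k i / M i i))"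
proof -
  have "(\<Sum>k\<in>T. A j k * (- M k i / M i i)) = - (\<Sum>k\<in>T. A j k * M k i) / M i i"
    by (simp add: sum_divide_distrib sum_negf)
  then show ?thesis using assms iT pivot_pos by (auto simp: pivot_products S_def)
qed

lemma pivot_row:
  assumes "j \<in> T" shows "A i j = (\<Sum>l\<in>T. (- M i l / M i i) * A l j)"
proof -
  have "(\<Sum>l\<in>T. (- M i l / M i i) * A l j) = - (\<Sum>k\<in>T. M i k * A k j) / M i i"
    by (simp add: sum_divide_distrib sum_negf)
  then show ?thesis using assms iT pivot_pos by (auto simp: pivot_products S_def)
qed

text \<open>The combination that reproduces row \<open>i\<close> on \<open>T\<close> falls short at
  the diagonal by \<open>1 / M i i\<close>. This gap is what makes the Schur complement of the
  powers positive.\<close>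

lemma pivot_diag: "(\<Sum>l\<in>T. (- M i l / M i i) * A l i) = A i i - 1 / M i i"
proof -
  have "(\<Sum>l\<in>T. (- M i l / M i i) * A l i) = - (\<Sum>k\<in>T. M i k * A k i) / M i i"
    by (simp add: sum_divide_distrib sum_negf)
  also have "(\<Sum>k\<in>T. M i k * A k i) = 1 - M i i * A i i"
    by (simp add: pivot_products S_def)
  finally show ?thesis using pivot_pos by (simp add: field_simps)
qed

lemma pivot_weights: "l \<in> T \<Longrightarrow> 0 \<le> - M i l / M i i" "l \<in> T \<Longrightarrow> 0 \<le> - M l i / M i i"
  using AM iT pivot_pos by (auto simp: inverse_M_on_def S_def intro!: divide_nonpos_pos)

lemma pivot_row_potential_le:
  assumes p: "1 \<le> p"
    and b: "\<And>l. l \<in> T \<Longrightarrow> 0 \<le> b l"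
    and x: "\<And>k. k \<in> T \<Longrightarrow> 0 \<le> x k"
    and Vx: "\<And>l. l \<in> T \<Longrightarrow> (\<Sum>k\<in>T. A l k powr p * x k) = b l powr p"
  shows "(\<Sum>k\<in>T. A i k powr p * x k) \<le> (\<Sum>l\<in>T. (- M i l / M i i) * b l) powr p"
proof -
  have "(\<Sum>k\<in>T. A i k powr p * x k) = (\<Sum>k\<in>T. (\<Sum>l\<in>T. (- M i l / M i i) * A l k) powr p * x k)"
    by (intro sum.cong arg_cong2[of _ _ _ _ "(*)"] arg_cong2[of _ _ _ _ "(powr)"] pivot_row) auto
  also have "\<dots> \<le> (\<Sum>l\<in>T. (- M i l / M i i) * b l) powr p"
    using AM by (intro powr_potential_le[OF fin p] pivot_weights b x Vx)
      (auto simp: inverse_M_on_def S_def)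
  finally show ?thesis .
qed

text \<open>Here column \<open>i\<close> itself is the potential \<open>b\<close>. The third claim
  is positivity of the Schur complement in the matrix of powers; the first two serve again for the
  diagonal of its inverse.\<close>

lemma pivot_schur_pos:
  assumes p: "1 \<le> p"
    and w: "\<And>k. k \<in> T \<Longrightarrow> 0 \<le> w k"
    and Vw: "\<And>l. l \<in> T \<Longrightarrow> (\<Sum>k\<in>T. A l k powr p * w k) = A l i powr p"
  shows "(\<Sum>k\<in>T. A i k powr p * w k) \<le> (A i i - 1 / M i i) powr p"
    and "0 \<le> A i i - 1 / M i i"
    and "0 < A i i powr p - (\<Sum>k\<in>T. A i k powr p * w k)"
proof -
  have nn: "\<And>l. l \<in> T \<Longrightarrow> 0 \<le> A l i" using AM by (auto simp: inverse_M_on_def S_def)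
  show 1: "(\<Sum>k\<in>T. A i k powr p * w k) \<le> (A i i - 1 / M i i) powr p"
    using pivot_row_potential_le[OF p nn w Vw] by (simp only: pivot_diag)
  show 2: "0 \<le> A i i - 1 / M i i"
    unfolding pivot_diag[symmetric] using nn pivot_weights by (intro sum_nonneg mult_nonneg_nonneg)
  have "(A i i - 1 / M i i) powr p < A i i powr p"
    using pivot_pos p 2 by (intro powr_less_mono2) auto
  then show "0 < A i i powr p - (\<Sum>k\<in>T. A i k powr p * w k)" using 1 by linarith
qed

end

section \<open>Nonnegative solutions for powers of potentials\<close>

text \<open>The vectors \<open>\<xi>\<close> parametrise the potentials. Injectivity is carried
  along so that solutions obtained from different pivots can be identified.\<close>

definition powr_solvable_on :: "'a set \<Rightarrow> ('a \<Rightarrow> 'a \<Rightarrow> real) \<Rightarrow> real \<Rightarrow> bool" where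
  "powr_solvable_on S A p \<longleftrightarrow>
    (\<forall>x. (\<forall>j\<in>S. (\<Sum>k\<in>S. A j k powr p * x k) = 0) \<longrightarrow> (\<forall>k\<in>S. x k = 0)) \<and>
    (\<forall>\<xi>. (\<forall>k\<in>S. 0 \<le> \<xi> k) \<longrightarrow>
      (\<exists>x. (\<forall>k\<in>S. 0 \<le> x k) \<and> (\<forall>j\<in>S. (\<Sum>k\<in>S. A j k powr p * x k) = (\<Sum>k\<in>S. A j k * \<xi> k) powr p)))"

lemma powr_solvable_on_ker:
  assumes "powr_solvable_on S A p" "\<And>j. j \<in> S \<Longrightarrow> (\<Sum>k\<in>S. A j k powr p * x k) = 0" "k \<in> S"
  shows "x k = 0"
  using conjunct1[OF assms(1)[unfolded powr_solvable_on_def], THEN spec[of _ x]] assms(2,3) by simp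

lemma powr_solvable_on_potential:
  assumes "powr_solvable_on S A p" "\<And>k. k \<in> S \<Longrightarrow> 0 \<le> \<xi> k"
  obtains x where "\<And>k. k \<in> S \<Longrightarrow> 0 \<le> x k"
    "\<And>j. j \<in> S \<Longrightarrow> (\<Sum>k\<in>S. A j k powr p * x k) = (\<Sum>k\<in>S. A j k * \<xi> k) powr p"
  using conjunct2[OF assms(1)[unfolded powr_solvable_on_def], THEN spec[of _ \<xi>]] assms(2) by auto

lemma powr_solvable_on_unique:
  assumes "powr_solvable_on S A p"
    and "\<And>j. j \<in> S \<Longrightarrow> (\<Sum>k\<in>S. A j k powr p * x k) = (\<Sum>k\<in>S. A j k powr p * y k)"
    and "k \<in> S"
  shows "x k = y k"
proof -
  have "(\<Sum>k\<in>S. A j k powr p * (x k - y k)) = 0" if "j \<in> S" for j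
    using assms(2)[OF that] by (simp add: right_diff_distrib sum_subtractf)
  then have "x k - y k = 0" by (rule powr_solvable_on_ker[OF assms(1) _ assms(3)])
  then show ?thesis by simp
qed

lemma powr_solvable_on_col:
  assumes "finite T" "i \<notin> T" "inverse_M_on (insert i T) A M" "powr_solvable_on T A p"
  obtains w where "\<And>k. k \<in> T \<Longrightarrow> 0 \<le> w k"
    "\<And>l. l \<in> T \<Longrightarrow> (\<Sum>k\<in>T. A l k powr p * w k) = A l i powr p"
proof -
  obtain w where w: "\<And>k. k \<in> T \<Longrightarrow> 0 \<le> w k"
    "\<And>j. j \<in> T \<Longrightarrow> (\<Sum>k\<in>T. A j k powr p * w k) = (\<Sum>k\<in>T. A j k * (- M k i / M i i)) powr p"
    using powr_solvable_on_potential[OF assms(4), of "\<lambda>k. - M k i / M i i"]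
      pivot_weights(2)[OF assms(1,2) refl assms(3)] by blast
  show ?thesis
  proof (rule that[OF w(1)])
    fix l assume "l \<in> T"
    then show "(\<Sum>k\<in>T. A l k powr p * w k) = A l i powr p"
      using w(2) pivot_col[OF assms(1,2) refl assms(3), of l] by (simp only:)
  qed
qed

text \<open>Block elimination with the Schur complement \<open>\<sigma>\<close>. Only the new
  coordinate \<open>i\<close> gets a sign, since the others are differences
  \<open>z k - c * w k\<close> of nonnegative numbers.\<close>

lemma powr_solvable_on_insert:
  assumes fin: "finite T" and iT: "i \<notin> T" and AM: "inverse_M_on (insert i T) A M"
    and p: "1 \<le> p" and solv: "powr_solvable_on T A p"
  shows "(\<forall>j\<in>insert i T. (\<Sum>k\<in>insert i T. A j k powr p * x k) = 0) \<Longrightarrow> \<forall>k\<in>insert i T. x k = 0"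
    and "(\<forall>k\<in>insert i T. 0 \<le> \<xi> k) \<Longrightarrow>
       \<exists>x. 0 \<le> x i \<and> (\<forall>j\<in>insert i T.
          (\<Sum>k\<in>insert i T. A j k powr p * x k) = (\<Sum>k\<in>insert i T. A j k * \<xi> k) powr p)"
proof -
  note pivot = fin iT refl AM
  obtain w where w: "\<And>k. k \<in> T \<Longrightarrow> 0 \<le> w k"
    "\<And>l. l \<in> T \<Longrightarrow> (\<Sum>k\<in>T. A l k powr p * w k) = A l i powr p"
    using powr_solvable_on_col[OF fin iT AM solv] by blast
  define \<sigma> where "\<sigma> = A i i powr p - (\<Sum>k\<in>T. A i k powr p * w k)"
  have \<sigma>: "0 < \<sigma>" unfolding \<sigma>_def by (rule pivot_schur_pos[OF pivot p w])
  have comb: "(\<Sum>k\<in>T. A j k powr p * (z k - c * w k))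
      = (\<Sum>k\<in>T. A j k powr p * z k) - c * (\<Sum>k\<in>T. A j k powr p * w k)" for j z c
    by (simp add: algebra_simps sum_subtractf sum_distrib_left)
  {
    assume z: "\<forall>j\<in>insert i T. (\<Sum>k\<in>insert i T. A j k powr p * x k) = 0"
    have xk: "x k = - x i * w k" if "k \<in> T" for k
    proof (rule powr_solvable_on_unique[OF solv _ that])
      fix j assume j: "j \<in> T"
      have "(\<Sum>k\<in>T. A j k powr p * (- x i * w k)) = - x i * (\<Sum>k\<in>T. A j k powr p * w k)"
        by (simp add: sum_distrib_left mult_ac)
      then show "(\<Sum>k\<in>T. A j k powr p * x k) = (\<Sum>k\<in>T. A j k powr p * (- x i * w k))"
        using z j fin iT w(2)[OF j] by (auto simp: mult_ac add_eq_0_iff)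
    qed
    have "(\<Sum>k\<in>T. A i k powr p * x k) = - x i * (\<Sum>k\<in>T. A i k powr p * w k)"
      using xk by (simp add: sum_distrib_left mult_ac)
    then have "x i * \<sigma> = 0" using z fin iT by (simp add: \<sigma>_def algebra_simps)
    then show "\<forall>k\<in>insert i T. x k = 0" using xk \<sigma> by auto
  next
    assume lam: "\<forall>k\<in>insert i T. 0 \<le> \<xi> k"
    define b where "b j = (\<Sum>k\<in>insert i T. A j k * \<xi> k)" for j
    have nn: "\<forall>j\<in>insert i T. 0 \<le> A j k" if "k \<in> insert i T" for k
      using AM that by (auto simp: inverse_M_on_def)
    have b0: "0 \<le> b j" if "j \<in> insert i T" for j
      unfolding b_def using nn lam that by (intro sum_nonneg mult_nonneg_nonneg) auto
    \<comment> \<open>Replacing column \<open>i\<close> by its combination from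
      \<open>pivot_col\<close> shows that \<open>b\<close> restricted to \<open>T\<close> is a
      potential of the submatrix, with coefficients \<open>\<nu>\<close>.\<close>
    define \<nu> where "\<nu> k = \<xi> k + \<xi> i * (- M k i / M i i)" for k
    have nu0: "0 \<le> \<nu> k" if "k \<in> T" for k
      unfolding \<nu>_def using lam pivot_weights(2)[OF pivot] that
      by (intro add_nonneg_nonneg mult_nonneg_nonneg) auto
    have nu: "(\<Sum>k\<in>T. A j k * \<nu> k) = b j" if "j \<in> T" for j
    proof -
      have "(\<Sum>k\<in>T. A j k * \<nu> k)
          = (\<Sum>k\<in>T. A j k * \<xi> k) + \<xi> i * (\<Sum>k\<in>T. A j k * (- M k i / M i i))"
        unfolding \<nu>_def sum_distrib_left sum.distrib[symmetric]
        by (intro sum.cong) (auto simp: algebra_simps)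
      then show ?thesis
        using fin iT pivot_col[OF pivot that] by (simp add: b_def)
    qed
    obtain z where z: "\<And>k. k \<in> T \<Longrightarrow> 0 \<le> z k"
      "\<And>j. j \<in> T \<Longrightarrow> (\<Sum>k\<in>T. A j k powr p * z k) = b j powr p"
      by (rule powr_solvable_on_potential[OF solv, of \<nu>]) (use nu0 nu in auto)
    \<comment> \<open>The combination of rows agrees with row \<open>i\<close> except in column
      \<open>i\<close>, where \<open>1 / M i i\<close> is missing, so this sum equals
      \<open>b i - \<xi> i / M i i\<close>.\<close>
    have "(\<Sum>l\<in>T. (- M i l / M i i) * b l)
        = (\<Sum>k\<in>insert i T. (\<Sum>l\<in>T. (- M i l / M i i) * A l k) * \<xi> k)"
      unfolding b_def sum_distrib_left sum_distrib_right
      by (subst sum.swap) (simp add: mult.assoc)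
    also have "\<dots> = (A i i - 1 / M i i) * \<xi> i + (\<Sum>k\<in>T. A i k * \<xi> k)"
    proof -
      have "(\<Sum>k\<in>T. (\<Sum>l\<in>T. (- M i l / M i i) * A l k) * \<xi> k) = (\<Sum>k\<in>T. A i k * \<xi> k)"
        by (intro sum.cong arg_cong[where f="\<lambda>c. c * \<xi> _"] pivot_row[OF pivot, symmetric]) auto
      then show ?thesis using fin iT by (simp only: sum.insert pivot_diag[OF pivot] not_False_eq_True)
    qed
    also have "\<dots> \<le> b i"
      using fin iT lam pivot_pos[OF pivot] by (simp add: b_def algebra_simps)
    finally have le: "(\<Sum>l\<in>T. (- M i l / M i i) * b l) \<le> b i" .
    have "(\<Sum>k\<in>T. A i k powr p * z k) \<le> (\<Sum>l\<in>T. (- M i l / M i i) * b l) powr p"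
      using z b0 by (intro pivot_row_potential_le[OF pivot p]) auto
    also have "\<dots> \<le> b i powr p"
      using le p b0 pivot_weights(1)[OF pivot]
      by (intro powr_mono2 sum_nonneg mult_nonneg_nonneg) auto
    finally have num: "0 \<le> b i powr p - (\<Sum>k\<in>T. A i k powr p * z k)" by simp
    \<comment> \<open>Subtracting \<open>c * w\<close> from \<open>z\<close> offsets column
      \<open>i\<close> in the rows of \<open>T\<close> for any \<open>c\<close>; row
      \<open>i\<close> then determines \<open>c\<close>.\<close>
    define c where "c = (b i powr p - (\<Sum>k\<in>T. A i k powr p * z k)) / \<sigma>"
    define x' where "x' k = (if k = i then c else z k - c * w k)" for k
    have x': "(\<Sum>k\<in>insert i T. A j k powr p * x' k)
        = A j i powr p * c + ((\<Sum>k\<in>T. A j k powr p * z k) - c * (\<Sum>k\<in>T. A j k powr p * w k))" for j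
    proof -
      have "(\<Sum>k\<in>T. A j k powr p * x' k) = (\<Sum>k\<in>T. A j k powr p * (z k - c * w k))"
        using iT by (intro sum.cong) (auto simp: x'_def)
      then show ?thesis using fin iT by (simp add: comb) (simp add: x'_def)
    qed
    have "c * \<sigma> = b i powr p - (\<Sum>k\<in>T. A i k powr p * z k)" using \<sigma> by (simp add: c_def)
    then have "(\<Sum>k\<in>insert i T. A i k powr p * x' k) = b i powr p"
      unfolding x' \<sigma>_def by (simp add: algebra_simps)
    moreover have "(\<Sum>k\<in>insert i T. A j k powr p * x' k) = b j powr p" if "j \<in> T" for j
      unfolding x' using w(2)[OF that] z(2)[OF that] by simp
    moreover have "0 \<le> x' i" using num \<sigma> by (simp add: x'_def c_def)
    ultimately show "\<exists>x. 0 \<le> x i \<and> (\<forall>j\<in>insert i T.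
          (\<Sum>k\<in>insert i T. A j k powr p * x k) = (\<Sum>k\<in>insert i T. A j k * \<xi> k) powr p)"
      by (intro exI[of _ x']) (auto simp only: b_def insert_iff)
  }
qed

text \<open>Strong induction with \<open>M\<close> generalised, because deleting an index changes
  the inverse. Each index of \<open>S\<close> serves as the added one in turn.\<close>

lemma inverse_M_on_powr_solvable_on:
  assumes "finite S" "inverse_M_on S A M" and p: "1 \<le> p"
  shows "powr_solvable_on S A p"
  using assms(1,2)
proof (induction S arbitrary: M rule: finite_psubset_induct)
  case (psubset S)
  have T: "powr_solvable_on (S - {i}) A p" "S = insert i (S - {i})" if "i \<in> S" for i
  proof -
    show S: "S = insert i (S - {i})" using that by auto
    show "powr_solvable_on (S - {i}) A p"
      using that psubset.hyps inverse_M_on_delete[OF _ _ S psubset.prems]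
      by (intro psubset.IH) auto
  qed
  show ?case
  proof (cases "S = {}")
    case True
    then show ?thesis by (simp add: powr_solvable_on_def)
  next
    case False
    note step = powr_solvable_on_insert[OF _ _ _ p, of "S - {i}" i A M for i]
    have inj: "\<forall>k\<in>S. x k = 0" if "\<forall>j\<in>S. (\<Sum>k\<in>S. A j k powr p * x k) = 0" for x
    proof -
      obtain i where "i \<in> S" using False by blast
      then show ?thesis using step(1)[of i x] T[of i] psubset that by auto
    qed
    have ex: "\<exists>x. (\<forall>k\<in>S. 0 \<le> x k) \<and>
        (\<forall>j\<in>S. (\<Sum>k\<in>S. A j k powr p * x k) = (\<Sum>k\<in>S. A j k * \<xi> k) powr p)"
      if lam: "\<forall>k\<in>S. 0 \<le> \<xi> k" for \<xi>
    proof -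
      have one: "\<exists>x. 0 \<le> x i \<and> (\<forall>j\<in>S. (\<Sum>k\<in>S. A j k powr p * x k) = (\<Sum>k\<in>S. A j k * \<xi> k) powr p)"
        if i: "i \<in> S" for i
        using step(2)[of i \<xi>] T[OF i] psubset lam i by (simp add: insert_absorb)
      then obtain x where x: "\<forall>j\<in>S. (\<Sum>k\<in>S. A j k powr p * x k) = (\<Sum>k\<in>S. A j k * \<xi> k) powr p"
        using False by blast
      \<comment> \<open>The solution \<open>x\<close> came from some arbitrary index. The solution
        \<open>y\<close> built with \<open>i\<close> added last is nonnegative at \<open>i\<close>,
        and injectivity identifies the two.\<close>
      have "0 \<le> x i" if i: "i \<in> S" for i
      proof -
        obtain y where y: "0 \<le> y i"
          "\<forall>j\<in>S. (\<Sum>k\<in>S. A j k powr p * y k) = (\<Sum>k\<in>S. A j k * \<xi> k) powr p"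
          using one[OF i] by blast
        have "\<forall>j\<in>S. (\<Sum>k\<in>S. A j k powr p * (x k - y k)) = 0"
          using x y by (simp add: right_diff_distrib sum_subtractf)
        then have "x i - y i = 0" using inj[of "\<lambda>k. x k - y k"] i by blast
        then show ?thesis using y(1) by simp
      qed
      then show ?thesis using x by blast
    qed
    show ?thesis unfolding powr_solvable_on_def using inj ex by blast
  qed
qed

section \<open>Entries of the inverse of the matrix of powers\<close>

text \<open>The rows in \<open>T\<close> force \<open>N k i = - N i i * w k\<close>, and row
  \<open>i\<close> gives \<open>N i i = 1 / \<sigma>\<close>. Hence the signs come from
  \<open>w\<close> being nonnegative, and the diagonal bound amounts to
  \<open>1 \<le> \<sigma>\<close>.\<close>

lemma inverse_M_on_powr_inverse_entries:
  assumes fin: "finite S" and AM: "inverse_M_on S A M" and p: "1 \<le> p"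
    and N: "\<And>j l. j \<in> S \<Longrightarrow> l \<in> S \<Longrightarrow> (\<Sum>k\<in>S. A j k powr p * N k l) = of_bool (j = l)"
    and i: "i \<in> S"
  shows "k \<in> S \<Longrightarrow> k \<noteq> i \<Longrightarrow> N k i \<le> 0"
    and "M i i \<le> 1 \<Longrightarrow> N i i \<le> 1"
proof -
  define T where "T = S - {i}"
  have S: "S = insert i T" and iT: "i \<notin> T" and finT: "finite T"
    using i fin by (auto simp: T_def)
  note pivot = finT iT S AM
  have solv: "powr_solvable_on T A p"
    by (rule inverse_M_on_powr_solvable_on[OF finT inverse_M_on_delete[OF pivot] p])
  obtain w where w: "\<And>k. k \<in> T \<Longrightarrow> 0 \<le> w k"
    "\<And>l. l \<in> T \<Longrightarrow> (\<Sum>k\<in>T. A l k powr p * w k) = A l i powr p"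
    using powr_solvable_on_col[OF finT iT AM[unfolded S] solv] by blast
  define \<sigma> where "\<sigma> = A i i powr p - (\<Sum>k\<in>T. A i k powr p * w k)"
  note schur = pivot_schur_pos[OF pivot p w]
  have Nk: "N k i = - N i i * w k" if "k \<in> T" for k
  proof (rule powr_solvable_on_unique[OF solv _ that])
    fix j assume j: "j \<in> T"
    have "(\<Sum>k\<in>T. A j k powr p * (- N i i * w k)) = - N i i * (\<Sum>k\<in>T. A j k powr p * w k)"
      by (simp add: sum_distrib_left mult_ac)
    also have "\<dots> = - N i i * A j i powr p" using w(2)[OF j] by simp
    also have "\<dots> = (\<Sum>k\<in>T. A j k powr p * N k i)"
    proof -
      have "j \<noteq> i" using j iT by blast
      then show ?thesis using N[of j i] j iT finT by (simp add: S mult.commute add_eq_0_iff)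
    qed
    finally show "(\<Sum>k\<in>T. A j k powr p * N k i) = (\<Sum>k\<in>T. A j k powr p * (- N i i * w k))"
      by simp
  qed
  have "(\<Sum>k\<in>T. A i k powr p * N k i) = - N i i * (\<Sum>k\<in>T. A i k powr p * w k)"
    using Nk by (simp add: sum_distrib_left mult_ac)
  then have one: "N i i * \<sigma> = 1"
    using N[OF i i] iT finT by (simp add: S \<sigma>_def algebra_simps)
  have \<sigma>: "0 < \<sigma>" unfolding \<sigma>_def by (rule schur)
  then have Nii: "N i i = 1 / \<sigma>" using one by (simp add: field_simps)
  show "N k i \<le> 0" if "k \<in> S" "k \<noteq> i"
    using that Nk[of k] w(1)[of k] \<sigma> by (simp add: S Nii)
  show "N i i \<le> 1" if M: "M i i \<le> 1"
  proof -
    define d where "d = A i i"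
    define s where "s = d - 1 / M i i"
    have s: "0 \<le> s" "s + 1 \<le> d"
      using schur(2) pivot_pos[OF pivot] M by (auto simp: s_def d_def)
    \<comment> \<open>The chain passes through \<open>(s + 1) * d powr (p - 1)\<close>, using that
      both \<open>s\<close> and \<open>1\<close> are at most \<open>d\<close>.\<close>
    have "s powr p + 1 \<le> s * s powr (p - 1) + 1"
      using s by (cases "s = 0") (auto simp: powr_diff)
    also have "\<dots> \<le> s * d powr (p - 1) + d powr (p - 1)"
      using s p by (intro add_mono mult_left_mono powr_mono2 ge_one_powr_ge_zero) auto
    also have "\<dots> \<le> d * d powr (p - 1)"
      using mult_right_mono[OF s(2), of "d powr (p - 1)"] by (simp add: algebra_simps)
    also have "\<dots> = d powr p" using s by (simp add: powr_diff)
    finally have "1 \<le> \<sigma>" using schur(1) by (simp add: \<sigma>_def s_def d_def)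
    then show ?thesis by (simp add: Nii)
  qed
qed

section \<open>Nonnegativity of the inverse of the identity minus a substochastic matrix\<close>

lemma matrix_inv_inverse:
  fixes A :: "'a::semiring_1 ^ 'n ^ 'm"
  assumes "invertible A"
  shows "A ** matrix_inv A = mat 1" "matrix_inv A ** A = mat 1"
  using someI_ex[OF assms[unfolded invertible_def]] unfolding matrix_inv_def by simp_all

text \<open>Row sums equal to 1 are allowed, so \<open>P\<close> need not be a contraction in the
  maximum norm; injectivity of \<open>mat 1 - P\<close> takes the place of strictness.\<close>

lemma substochastic_minimum_principle:
  fixes P :: "real ^ 'n ^ 'n"
  assumes P: "0 \<le> P" "P *v 1 \<le> 1"
    and inj: "\<And>x. P *v x = x \<Longrightarrow> x = 0"
    and x: "P *v x \<le> x"
  shows "0 \<le> x"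
proof -
  have P0: "0 \<le> P $ i $ j" for i j
    using P(1) by (simp add: less_eq_vec_def)
  have P1: "(\<Sum>j\<in>UNIV. P $ i $ j) \<le> 1" for i
    using P(2) by (simp add: less_eq_vec_def matrix_vector_mult_def)
  have mono: "P *v u \<le> P *v v" if "u \<le> v" for u v
    using that P0 by (auto simp: less_eq_vec_def matrix_vector_mult_def intro!: sum_mono mult_left_mono)
  \<comment> \<open>The iterates \<open>P\<^sup>n x\<close> decrease to a fixed point of \<open>P\<close>, which has to be \<open>0\<close>.\<close>
  define y where "y n = (((*v) P) ^^ n) x" for n
  have yS: "y (Suc n) = P *v y n" for n by (simp add: y_def)
  have dec: "y (Suc n) \<le> y n" for n
    by (induction n) (use x mono in \<open>auto simp: yS y_def\<close>)
  \<comment> \<open>Row sums at most 1 move the constant vector with entries \<open>- norm x\<close>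
    only upwards, so it stays below every iterate.\<close>
  have low: "- norm x \<le> y n $ i" for n i
  proof (induction n arbitrary: i)
    case 0
    show ?case using component_le_norm_cart[of x i] by (simp add: y_def)
  next
    case (Suc n)
    have "- norm x \<le> (\<Sum>j\<in>UNIV. P $ i $ j) * - norm x"
      using mult_right_mono[OF P1[of i], of "norm x"] by simp
    also have "\<dots> \<le> (\<Sum>j\<in>UNIV. P $ i $ j * y n $ j)"
      unfolding sum_distrib_right using Suc P0 by (intro sum_mono mult_left_mono)
    finally show ?case by (simp add: yS matrix_vector_mult_def)
  qed
  have "\<exists>L. (\<lambda>n. y n $ i) \<longlonglongrightarrow> L \<and> L \<le> y 0 $ i" for i
  proof -
    have "decseq (\<lambda>n. y n $ i)" using dec by (auto simp: decseq_Suc_iff less_eq_vec_def)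
    then show ?thesis using low by (metis decseq_convergent)
  qed
  then obtain L where L: "\<And>i. (\<lambda>n. y n $ i) \<longlonglongrightarrow> L i" "\<And>i. L i \<le> y 0 $ i" by metis
  have "P *v (\<chi> i. L i) = (\<chi> i. L i)"
  proof (subst vec_eq_iff, intro allI)
    fix i
    have "(\<lambda>n. y (Suc n) $ i) \<longlonglongrightarrow> (\<Sum>j\<in>UNIV. P $ i $ j * L j)"
      unfolding yS matrix_vector_mult_def by (simp, intro tendsto_intros L)
    with L(1)[of i, THEN LIMSEQ_Suc] have "(\<Sum>j\<in>UNIV. P $ i $ j * L j) = L i"
      using LIMSEQ_unique by blast
    then show "(P *v (\<chi> i. L i)) $ i = (\<chi> i. L i) $ i" by (simp add: matrix_vector_mult_def)
  qed
  from inj[OF this] have "L i = 0" for i by (simp add: vec_eq_iff)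
  then show ?thesis using L(2) by (simp add: less_eq_vec_def y_def)
qed

text \<open>Multiplying a column of \<open>U\<close> by \<open>mat 1 - P\<close> gives a unit
  vector, which is nonnegative, so the minimum principle applies to the column.\<close>

lemma inverse_substochastic_nonneg:
  fixes U P :: "real ^ 'n ^ 'n"
  assumes U: "invertible U" and inv: "matrix_inv U = mat 1 - P" and P: "0 \<le> P" "P *v 1 \<le> 1"
  shows "0 \<le> U"
proof -
  note id = matrix_inv_inverse[OF U, unfolded inv]
  have "0 \<le> column j U" for j
  proof (rule substochastic_minimum_principle[OF P])
    show "x = 0" if "P *v x = x" for x
    proof -
      have "(mat 1 - P) *v x = 0" using that by (simp add: matrix_vector_mult_diff_rdistrib)
      then have "(U ** (mat 1 - P)) *v x = 0" by (simp flip: matrix_vector_mul_assoc)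
      then show ?thesis by (simp add: id)
    qed
    have "(mat 1 - P) *v column j U = column j ((mat 1 - P) ** U)"
      by (simp add: vec_eq_iff column_def matrix_matrix_mult_def matrix_vector_mult_def)
    then have "column j U - P *v column j U = column j (mat 1)"
      by (simp add: id matrix_vector_mult_diff_rdistrib)
    moreover have "0 \<le> column j (mat 1 :: real ^ 'n ^ 'n)"
      by (simp add: less_eq_vec_def column_def mat_def)
    ultimately show "P *v column j U \<le> column j U" by (metis diff_ge_0_iff_ge)
  qed
  then show ?thesis by (simp add: less_eq_vec_def column_def)
qed

section \<open>Row sums of the inverse of the powers, and transfer to matrices\<close>

text \<open>The row sums of \<open>M\<close> are the coefficients that exhibit the vector of ones as
  a potential. Its powers are again ones, so the nonnegative solution for it is the vector of row
  sums of \<open>N\<close>.\<close>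

lemma inverse_M_on_powr_inverse_row_sum:
  assumes fin: "finite S" and AM: "inverse_M_on S A M" and p: "1 \<le> p"
    and N: "\<And>j l. j \<in> S \<Longrightarrow> l \<in> S \<Longrightarrow> (\<Sum>k\<in>S. A j k powr p * N k l) = of_bool (j = l)"
    and M: "\<And>k. k \<in> S \<Longrightarrow> 0 \<le> (\<Sum>l\<in>S. M k l)"
    and k: "k \<in> S"
  shows "0 \<le> (\<Sum>l\<in>S. N k l)"
proof -
  note solv = inverse_M_on_powr_solvable_on[OF fin AM p]
  obtain x where x: "\<And>k. k \<in> S \<Longrightarrow> 0 \<le> x k"
    "\<And>j. j \<in> S \<Longrightarrow> (\<Sum>k\<in>S. A j k powr p * x k) = (\<Sum>k\<in>S. A j k * (\<Sum>l\<in>S. M k l)) powr p"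
    using powr_solvable_on_potential[OF solv, of "\<lambda>k. \<Sum>l\<in>S. M k l"] M by blast
  have "x k = (\<Sum>l\<in>S. N k l)"
  proof (rule powr_solvable_on_unique[OF solv _ k])
    fix j assume j: "j \<in> S"
    have "(\<Sum>k\<in>S. A j k * (\<Sum>l\<in>S. M k l)) = (\<Sum>l\<in>S. \<Sum>k\<in>S. A j k * M k l)"
      unfolding sum_distrib_left by (rule sum.swap)
    also have "\<dots> = 1" using AM j fin by (simp add: inverse_M_on_def of_bool_def)
    finally have "(\<Sum>k\<in>S. A j k powr p * x k) = 1" using x j by simp
    also have "1 = (\<Sum>l\<in>S. \<Sum>k\<in>S. A j k powr p * N k l)"
      using N j fin by (simp add: of_bool_def)
    also have "\<dots> = (\<Sum>k\<in>S. A j k powr p * (\<Sum>l\<in>S. N k l))"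
      unfolding sum_distrib_left by (rule sum.swap)
    finally show "(\<Sum>k\<in>S. A j k powr p * x k) = (\<Sum>k\<in>S. A j k powr p * (\<Sum>l\<in>S. N k l))" .
  qed
  then show ?thesis using x(1)[OF k] by simp
qed

theorem theorem2p3:
  fixes U P :: "real ^ 'n ^ 'n"
  assumes "invertible U"
    and "matrix_inv U = mat 1 - P"
    and "0 \<le> P"
    and "P *v 1 \<le> 1"
  shows "\<forall>\<alpha>::real. 1 \<le> \<alpha> \<longrightarrow>
    (\<exists>Q :: real ^ 'n ^ 'n. 0 \<le> Q \<and> Q *v 1 \<le> 1 \<and>
      invertible (entrywise_powr U \<alpha>) \<and>
      matrix_inv (entrywise_powr U \<alpha>) = mat 1 - Q \<and>
      (transpose P *v 1 \<le> 1 \<longrightarrow> transpose Q *v 1 \<le> 1))"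
proof (intro allI impI)
  fix \<alpha> :: real assume \<alpha>: "1 \<le> \<alpha>"
  define V where "V = entrywise_powr U \<alpha>"
  define A where "A i j = U $ i $ j" for i j
  define M where "M i j = of_bool (i = j) - P $ i $ j" for i j
  have P0: "0 \<le> P $ i $ j" for i j
    using assms(3) by (simp add: less_eq_vec_def)
  note id = matrix_inv_inverse[OF assms(1), unfolded assms(2), unfolded vec_eq_iff]
  have AM: "inverse_M_on UNIV A M"
    unfolding inverse_M_on_def
  proof (intro conjI ballI impI)
    show "0 \<le> A i j" for i j
      using inverse_substochastic_nonneg[OF assms] by (simp add: less_eq_vec_def A_def)
    show "M i j \<le> 0" if "i \<noteq> j" for i j using that P0 by (simp add: M_def)
    show "(\<Sum>k\<in>UNIV. A i k * M k j) = of_bool (i = j)"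
      "(\<Sum>k\<in>UNIV. M i k * A k j) = of_bool (i = j)" for i j
      using id[rule_format, of i j]
      by (simp_all add: A_def M_def matrix_matrix_mult_def mat_def of_bool_def)
  qed
  note solv = inverse_M_on_powr_solvable_on[OF finite AM \<alpha>]
  have V: "V $ i $ j = A i j powr \<alpha>" for i j
    by (simp add: V_def entrywise_powr_def A_def)
  have "x = 0" if "V *v x = 0" for x
  proof -
    have "(\<Sum>k\<in>UNIV. A j k powr \<alpha> * x $ k) = 0" for j
      using that by (simp add: vec_eq_iff matrix_vector_mult_def V)
    then have "x $ k = 0" for k by (rule powr_solvable_on_ker[OF solv _ UNIV_I])
    then show ?thesis by (simp add: vec_eq_iff)
  qed
  then have Vinv: "invertible V"
    by (metis invertible_left_inverse matrix_left_invertible_ker)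
  note idV = matrix_inv_inverse[OF Vinv, unfolded vec_eq_iff]
  define N where "N i j = matrix_inv V $ i $ j" for i j
  \<comment> \<open>The second identity is written for the transposes of \<open>A\<close> and
    \<open>N\<close>, the form that the column sums require.\<close>
  have N: "(\<Sum>k\<in>UNIV. A j k powr \<alpha> * N k l) = of_bool (j = l)"
    "(\<Sum>k\<in>UNIV. A k j powr \<alpha> * N l k) = of_bool (j = l)" for j l
    using idV(1)[rule_format, of j l] idV(2)[rule_format, of l j]
    by (auto simp: N_def matrix_matrix_mult_def mat_def of_bool_def V mult.commute)
  define Q where "Q = mat 1 - matrix_inv V"
  have Q: "Q $ i $ j = of_bool (i = j) - N i j" for i j
    by (simp add: Q_def N_def mat_def)
  have "M i i \<le> 1" for i using P0 by (simp add: M_def)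
  then have "0 \<le> Q $ i $ j" for i j
    using inverse_M_on_powr_inverse_entries(1)[OF finite AM \<alpha> N(1) UNIV_I UNIV_I, of i j]
      inverse_M_on_powr_inverse_entries(2)[OF finite AM \<alpha> N(1) UNIV_I, of i] by (cases "i = j") (auto simp: Q)
  then have Q0: "0 \<le> Q" by (simp add: less_eq_vec_def)
  have "0 \<le> (\<Sum>l\<in>UNIV. M k l)" for k
    using assms(4) by (simp add: M_def sum_subtractf less_eq_vec_def matrix_vector_mult_def of_bool_def)
  then have "0 \<le> (\<Sum>l\<in>UNIV. N k l)" for k
    using inverse_M_on_powr_inverse_row_sum[OF finite AM \<alpha> N(1)] by simp
  then have Q1: "Q *v 1 \<le> 1"
    by (simp add: Q sum_subtractf less_eq_vec_def matrix_vector_mult_def of_bool_def)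
  have "transpose Q *v 1 \<le> 1" if "transpose P *v 1 \<le> 1"
  proof -
    have "0 \<le> (\<Sum>l\<in>UNIV. M l k)" for k
      using that by (simp add: M_def sum_subtractf less_eq_vec_def matrix_vector_mult_def transpose_def of_bool_def)
    then have "0 \<le> (\<Sum>l\<in>UNIV. N l k)" for k
      using inverse_M_on_powr_inverse_row_sum[OF finite inverse_M_on_transpose[OF AM] \<alpha>, of "\<lambda>i j. N j i"] N(2)
      by simp
    then show ?thesis
      by (simp add: Q sum_subtractf less_eq_vec_def matrix_vector_mult_def transpose_def of_bool_def)
  qed
  moreover have "matrix_inv V = mat 1 - Q" by (simp add: Q_def)
  ultimately show "\<exists>Q :: real ^ 'n ^ 'n. 0 \<le> Q \<and> Q *v 1 \<le> 1 \<and>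
      invertible (entrywise_powr U \<alpha>) \<and>
      matrix_inv (entrywise_powr U \<alpha>) = mat 1 - Q \<and>
      (transpose P *v 1 \<le> 1 \<longrightarrow> transpose Q *v 1 \<le> 1)"
    using Q0 Q1 Vinv unfolding V_def by blast
qed

end
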